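(* If each robot can see the coordinate systems of all the other robots and the system has chirality, then there exists an algorithm that solves \textsc{Visit-All} in $1$ step from every initial configuration $C_0$.
   Context: Model. There are $n\ge 2$ robots $r_0,\dots,r_{n-1}$, which are points in $\mathbb R^2$. A configuration is a tuple $C=(p_0,\dots,p_{n-1})$ of points, $p_i$ being the position of $r_i$ in a fixed global coordinate system unknown to the robots; an initial configuration consists of pairwise distinct points. Each robot $r_i$ has a local Cartesian coordinate system $Z_i$, always centred at its current position, whose orientation and unit length are fixed over time but arbitrary and possibly different for different robots. Chirality: all $Z_i$ have the same handedness (the robots agree on the clockwise direction). Robots are anonymous, oblivious and deterministic, and coordinate systems are visible: an algorithm $\mathcal A$ is one function, the same for all robots, mapping a snapshot to a destination point in the observing robot's local coordinates, where the snapshot is the multiset of pairs (position, local coordinate system) of all robots, expressed in the observing robot's local coordinate system (its own position being the origin). In each round all robots simultaneously take a snapshot, compute their destination, and move exactly to it. Thus $C_0$ and $Z=(Z_0,\dots,Z_{n-1})$ determine the run $(C_0,C_1,C_2,\dots)$ of $\mathcal A$. Permutations. For a permutation $\pi$ of $\{0,\dots,n-1\}$ put $\pi(C)=(p_{\pi(0)},\dots,p_{\pi(n-1)})$. $\Pi_n$ is the set of permutations that are a single $n$-cycle. Problem. $\mathcal A$ solves \textsc{Visit-All} in $1$ step from $C_0$ if for every admissible $Z$ the run from $C_0$ satisfies: there is $\pi\in\Pi_n$ with $C_i=\pi^i(C_0)$ for all $i\ge 0$. *)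

theory Defs
  imports "HOL-Analysis.Analysis" "HOL-Combinatorics.Orbits" "HOL-Library.Multiset"
begin

type_synonym point = "real ^ 2"

(* A frame is a local coordinate system without its origin: the origin is always the current
   position of the robot that owns it. The two axis vectors carry the orientation and the unit
   length. *)
datatype frame = Frame (x_axis: point) (y_axis: point)

definition cartesian :: "frame \<Rightarrow> bool" where
  "cartesian F \<longleftrightarrow>
     x_axis F \<noteq> 0 \<and> norm (x_axis F) = norm (y_axis F) \<and> x_axis F \<bullet> y_axis F = 0"

definition handedness :: "frame \<Rightarrow> real" where
  "handedness F = sgn (det (vector [x_axis F, y_axis F] :: real ^ 2 ^ 2))"

definition frame_comb :: "frame \<Rightarrow> point \<Rightarrow> point" where
  "frame_comb F a = a $ 1 *\<^sub>R x_axis F + a $ 2 *\<^sub>R y_axis F"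

(* The coefficients of a vector in a cartesian frame, that is, the inverse of frame_comb F
   (see the two lemmas below). *)
definition frame_coords :: "frame \<Rightarrow> point \<Rightarrow> point" where
  "frame_coords F v =
     vector [(v \<bullet> x_axis F) / (x_axis F \<bullet> x_axis F), (v \<bullet> y_axis F) / (y_axis F \<bullet> y_axis F)]"

lemma frame_coords_comb:
  assumes "cartesian F"
  shows "frame_coords F (frame_comb F a) = a"
proof -
  have "x_axis F \<noteq> 0" "y_axis F \<noteq> 0" and o: "x_axis F \<bullet> y_axis F = 0"
    using assms by (auto simp: cartesian_def)
  then have "x_axis F \<bullet> x_axis F \<noteq> 0" "y_axis F \<bullet> y_axis F \<noteq> 0" "y_axis F \<bullet> x_axis F = 0"
    by (simp_all only: inner_eq_zero_iff not_False_eq_True inner_commute)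
  with o show ?thesis
    unfolding frame_coords_def frame_comb_def vec_eq_iff forall_2 vector_2 inner_add_left
      inner_scaleR_left by simp
qed

lemma frame_comb_coords:
  assumes "cartesian F"
  shows "frame_comb F (frame_coords F v) = v"
proof -
  obtain x y where F: "F = Frame x y" by (cases F)
  define N where "N = x \<bullet> x"
  have "N \<noteq> 0" using assms by (simp only: N_def F cartesian_def frame.sel inner_eq_zero_iff not_False_eq_True)
  moreover have "N = x $ 1 * x $ 1 + x $ 2 * x $ 2" "N = y $ 1 * y $ 1 + y $ 2 * y $ 2"
    "x $ 1 * y $ 1 + x $ 2 * y $ 2 = 0" "y \<bullet> y = N"
    using assms by (auto simp: F N_def cartesian_def norm_eq inner_vec_def sum_2)
  ultimately have N: "N \<noteq> 0" "N = x $ 1 * x $ 1 + x $ 2 * x $ 2" "N = y $ 1 * y $ 1 + y $ 2 * y $ 2"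
    and o: "x $ 1 * y $ 1 + x $ 2 * y $ 2 = 0" and yy: "y \<bullet> y = N" by blast+
  define D where "D = x $ 1 * y $ 2 - x $ 2 * y $ 1"
  have DD: "D * D = N * N" using N(2,3) o unfolding D_def by algebra
  have "D * (x $ 1 * x $ 1 + y $ 1 * y $ 1) = D * N"
    "D * (x $ 2 * x $ 2 + y $ 2 * y $ 2) = D * N"
    "D * (x $ 1 * x $ 2 + y $ 1 * y $ 2) = 0"
    using N(2,3) o unfolding D_def by algebra+
  moreover have "D \<noteq> 0" using DD N(1) by auto
  ultimately have e: "x $ 1 * x $ 1 + y $ 1 * y $ 1 = N" "x $ 2 * x $ 2 + y $ 2 * y $ 2 = N"
    "x $ 1 * x $ 2 + y $ 1 * y $ 2 = 0" by auto
  have "(v \<bullet> x) * x $ 1 + (v \<bullet> y) * y $ 1 =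
      v $ 1 * (x $ 1 * x $ 1 + y $ 1 * y $ 1) + v $ 2 * (x $ 1 * x $ 2 + y $ 1 * y $ 2)"
    "(v \<bullet> x) * x $ 2 + (v \<bullet> y) * y $ 2 =
      v $ 1 * (x $ 1 * x $ 2 + y $ 1 * y $ 2) + v $ 2 * (x $ 2 * x $ 2 + y $ 2 * y $ 2)"
    by (simp_all add: inner_vec_def sum_2 algebra_simps)
  then have "(v \<bullet> x) * x $ 1 + (v \<bullet> y) * y $ 1 = v $ 1 * N"
    "(v \<bullet> x) * x $ 2 + (v \<bullet> y) * y $ 2 = v $ 2 * N"
    using e by simp_all
  with N(1) show ?thesis
    by (simp add: F frame_comb_def frame_coords_def vec_eq_iff forall_2 yy
        flip: N_def add_divide_distrib)
qed

definition frame_in_frame :: "frame \<Rightarrow> frame \<Rightarrow> frame" where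
  "frame_in_frame F G = Frame (frame_coords F (x_axis G)) (frame_coords F (y_axis G))"

(* Robots are the numbers below n; values of configurations and of frame assignments at
   other indices are irrelevant. *)
type_synonym config = "nat \<Rightarrow> point"

type_synonym snapshot = "(point \<times> frame) multiset"

type_synonym algorithm = "snapshot \<Rightarrow> point"

definition snapshot :: "nat \<Rightarrow> (nat \<Rightarrow> frame) \<Rightarrow> config \<Rightarrow> nat \<Rightarrow> snapshot" where
  "snapshot n Z C i =
     image_mset (\<lambda>j. (frame_coords (Z i) (C j - C i), frame_in_frame (Z i) (Z j)))
       (mset_set {..<n})"

definition robot_step :: "nat \<Rightarrow> algorithm \<Rightarrow> (nat \<Rightarrow> frame) \<Rightarrow> config \<Rightarrow> config" where
  "robot_step n A Z C = (\<lambda>i. C i + frame_comb (Z i) (A (snapshot n Z C i)))"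

definition run :: "nat \<Rightarrow> algorithm \<Rightarrow> (nat \<Rightarrow> frame) \<Rightarrow> config \<Rightarrow> nat \<Rightarrow> config" where
  "run n A Z C0 t = (robot_step n A Z ^^ t) C0"

definition initial_config :: "nat \<Rightarrow> config \<Rightarrow> bool" where
  "initial_config n C \<longleftrightarrow> inj_on C {..<n}"

(* Chirality fixes a common handedness of all frames, but not which of the two it is relative
   to the global coordinate system. *)
definition admissible :: "nat \<Rightarrow> (nat \<Rightarrow> frame) \<Rightarrow> bool" where
  "admissible n Z \<longleftrightarrow>
     (\<forall>i<n. cartesian (Z i)) \<and> (\<forall>i<n. \<forall>j<n. handedness (Z i) = handedness (Z j))"

definition n_cycles :: "nat \<Rightarrow> (nat \<Rightarrow> nat) set" where
  "n_cycles n = {\<pi>. \<pi> permutes {..<n} \<and> cyclic_on \<pi> {..<n}}"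

definition permute_config :: "(nat \<Rightarrow> nat) \<Rightarrow> config \<Rightarrow> config" where
  "permute_config \<pi> C = (\<lambda>j. C (\<pi> j))"

definition solves_visit_all_1 :: "nat \<Rightarrow> algorithm \<Rightarrow> config \<Rightarrow> bool" where
  "solves_visit_all_1 n A C0 \<longleftrightarrow>
     (\<forall>Z. admissible n Z \<longrightarrow>
        (\<exists>\<pi>\<in>n_cycles n. \<forall>t. \<forall>j<n. run n A Z C0 t j = (permute_config \<pi> ^^ t) C0 j))"

end

theory Submission
  imports Defs
begin

text \<open>The set of occupied positions and the multiset of axis vectors do not change when the robots
  permute their positions, so it suffices to choose, equivariantly under orientation-preserving
  similarities, a cyclic permutation of the positions depending only on these two data. Identify
  the plane with the complex numbers and put the origin at the centroid. A rotation \<open>a\<close> preserving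
  both data satisfies \<open>a ^ n = 1\<close>, by multiplying all axis vectors together; if the origin is
  occupied, multiplying the other positions together also gives \<open>a ^ (n - 1) = 1\<close>, so \<open>a = 1\<close>.
  Hence the symmetry group is a finite cyclic group acting freely on the positions. With a
  generator \<open>g\<close> and orbit representatives \<open>q\<^sub>0, \<dots>, q\<^sub>m\<^sub>-\<^sub>1\<close> the cycle visits
  \<open>q\<^sub>0, \<dots>, q\<^sub>m\<^sub>-\<^sub>1, g q\<^sub>0, \<dots>, g q\<^sub>m\<^sub>-\<^sub>1, g\<^sup>2 q\<^sub>0, \<dots>\<close> and
  commutes with the group. Choosing such a cycle for one representative of each similarity class
  and transporting it gives the algorithm.\<close>

section \<open>Finite multiplicative groups of complex numbers\<close>

text \<open>Multiplication by \<open>a\<close> permutes \<open>G\<close>, so comparing the product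
  of all elements before and after gives \<open>a ^ card G = 1\<close>. Hence \<open>G\<close> lies
  among the roots of unity of order dividing \<open>card G\<close>, and there are exactly
  \<open>card G\<close> of these.\<close>

lemma finite_unit_group_eq_roots_unity:
  fixes G :: "complex set"
  assumes fin: "finite G" and one: "1 \<in> G" and zero: "0 \<notin> G"
    and mult: "\<And>a b. a \<in> G \<Longrightarrow> b \<in> G \<Longrightarrow> a * b \<in> G"
  shows "G = {a. a ^ card G = 1}"
proof -
  have k: "card G > 0" using fin one by (auto simp: card_gt_0_iff)
  have "a ^ card G = 1" if a: "a \<in> G" for a
  proof -
    have inj: "inj_on ((*) a) G" using a zero by (auto simp: inj_on_def)
    have "(*) a ` G = G"
      using fin a mult by (intro card_subset_eq) (auto simp: card_image[OF inj])
    then have "\<Prod>G = prod id ((*) a ` G)" by simp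
    also have "\<dots> = a ^ card G * \<Prod>G" by (simp add: prod.reindex[OF inj] prod.distrib)
    finally show ?thesis using fin zero by auto
  qed
  then have "G \<subseteq> {a. a ^ card G = 1}" by blast
  moreover have "card {a::complex. a ^ card G = 1} = card G"
    using k by (rule card_roots_unity_eq)
  moreover have "finite {a::complex. a ^ card G = 1}"
    using k by (intro finite_roots_unity) simp
  ultimately show ?thesis by (intro card_subset_eq) auto
qed

lemma finite_unit_group_cyclic:
  fixes G :: "complex set"
  assumes "finite G" "1 \<in> G" "0 \<notin> G"
    and "\<And>a b. a \<in> G \<Longrightarrow> b \<in> G \<Longrightarrow> a * b \<in> G"
  obtains g k where "k > 0" "g ^ k = 1" "G = range (\<lambda>p. g ^ p)"
proof
  define k where "k = card G"
  define g where "g = cis (2 * pi / k)"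
  have G: "G = {a. a ^ k = 1}"
    unfolding k_def by (rule finite_unit_group_eq_roots_unity) (use assms in auto)
  show k: "k > 0" using assms(1,2) by (auto simp: k_def card_gt_0_iff)
  have pw: "cis (2 * pi * real p / real k) = g ^ p" for p
    by (simp add: g_def Complex.DeMoivre mult_ac)
  then have "g ^ p \<in> G" if "p < k" for p
    using Complex.bij_betw_roots_unity[OF k] that unfolding G bij_betw_def by force
  show gk: "g ^ k = 1"
    using k by (simp add: g_def Complex.DeMoivre)
  show "G = range (\<lambda>p. g ^ p)"
  proof
    show "G \<subseteq> range (\<lambda>p. g ^ p)"
      using Complex.bij_betw_roots_unity[OF k] unfolding G bij_betw_def pw by auto
    show "range (\<lambda>p. g ^ p) \<subseteq> G"
      using gk by (auto simp: G) (metis power_mult mult.commute power_one)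
  qed
qed

section \<open>Cycles commuting with a free group action\<close>

text \<open>\<open>orbit\<close> contains only the positive iterates of its starting point, so
  \<open>e 0\<close> has to recur at a positive index.\<close>

lemma cyclic_on_enumeration:
  fixes e :: "nat \<Rightarrow> 'a"
  assumes step: "\<And>j. \<sigma> (e j) = e (Suc j)" and zero: "e 0 \<in> e ` {0<..}"
  shows "cyclic_on \<sigma> (range e)"
proof (rule cyclic_on_singleI)
  have "(\<sigma> ^^ j) (e 0) = e j" for j by (induction j) (simp_all add: step)
  then have "orbit \<sigma> (e 0) = e ` {0<..}" by (auto simp: orbit_altdef)
  moreover have "e j \<in> e ` {0<..}" for j
    using zero by (cases j) auto
  then have "range e = e ` {0<..}" by blast
  ultimately show "range e = orbit \<sigma> (e 0)" by simp
qed simp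

lemma equivariant_cycle:
  fixes G Q :: "complex set"
  assumes G: "finite G" "1 \<in> G" "0 \<notin> G" "\<And>a b. a \<in> G \<Longrightarrow> b \<in> G \<Longrightarrow> a * b \<in> G"
    and Q: "finite Q" "Q \<noteq> {}"
    and act: "\<And>a z. a \<in> G \<Longrightarrow> z \<in> Q \<Longrightarrow> a * z \<in> Q"
    and free: "\<And>a z. a \<in> G \<Longrightarrow> z \<in> Q \<Longrightarrow> a * z = z \<Longrightarrow> a = 1"
  obtains \<sigma> where "cyclic_on \<sigma> Q" "\<And>a z. a \<in> G \<Longrightarrow> z \<in> Q \<Longrightarrow> \<sigma> (a * z) = a * \<sigma> z"
proof -
  obtain g k where k: "k > 0" and gk: "g ^ k = 1" and Gg: "G = range (\<lambda>p. g ^ p)"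
    using finite_unit_group_cyclic G by metis
  \<comment> \<open>The choice depends on \<open>z\<close> only through its orbit as a set, so
    \<open>r\<close> is constant on orbits and picks one representative of each.\<close>
  define r where "r z = (SOME w. w \<in> (\<lambda>a. a * z) ` G)" for z
  have r_ex: "\<exists>a\<in>G. r z = a * z" for z
    using someI_ex[of "\<lambda>w. w \<in> (\<lambda>a. a * z) ` G"] G(2) unfolding r_def by blast
  have inv: "\<exists>b\<in>G. b * a = 1" if "a \<in> G" for a
  proof -
    from that obtain p where p: "a = g ^ p" by (auto simp: Gg)
    have "p * (k - 1) + p = k * p" using k by (cases k) simp_all
    then have "g ^ (p * (k - 1)) * a = (g ^ k) ^ p"
      by (simp only: p flip: power_add power_mult)
    then show ?thesis using gk by (auto simp: Gg)
  qed
  have r_inv: "r (a * z) = r z" if a: "a \<in> G" for a z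
  proof -
    obtain b where b: "b \<in> G" "b * a = 1" using inv a by blast
    have "(\<lambda>c. c * (a * z)) ` G = (\<lambda>c. c * z) ` G"
    proof (intro set_eqI iffI)
      fix w assume "w \<in> (\<lambda>c. c * z) ` G"
      then obtain c where c: "c \<in> G" "w = c * z" by auto
      then have "w = (c * b) * (a * z)" using b(2) by (simp add: algebra_simps)
      then show "w \<in> (\<lambda>c. c * (a * z)) ` G" using c(1) b(1) G(4) by blast
    qed (use a G(4) in \<open>auto simp flip: mult.assoc\<close>)
    then show ?thesis by (simp add: r_def)
  qed
  define T where "T = r ` Q"
  have TQ: "T \<subseteq> Q" unfolding T_def using r_ex act by (metis image_subsetI)
  have rT: "r t = t" if "t \<in> T" for t
    using that r_ex r_inv unfolding T_def by (metis imageE)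
  define m where "m = card T"
  have "finite T" using Q by (simp add: T_def)
  then obtain q where q: "bij_betw q {0..<m} T" using ex_bij_betw_nat_finite unfolding m_def by blast
  have m: "m > 0" using Q \<open>finite T\<close> by (auto simp: m_def T_def card_gt_0_iff)
  have qT: "q i \<in> T" if "i < m" for i using q that by (auto simp: bij_betw_def)
  \<comment> \<open>The enumeration runs over all naturals and repeats with period
    \<open>m * k\<close>. Advancing the index by \<open>m\<close> multiplies by \<open>g\<close>;
    this makes the successor map commute with the group.\<close>
  define e where "e j = g ^ (j div m) * q (j mod m)" for j
  have e_Q: "e j \<in> Q" for j
    unfolding e_def using m qT TQ by (intro act) (auto simp: Gg)
  have e_shift: "e (j + m * p) = g ^ p * e j" for j p
    using m by (simp add: e_def power_add mult_ac)
  have e_surj: "\<exists>j>0. e j = z" if z: "z \<in> Q" for z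
  proof -
    obtain a where a: "a \<in> G" "r z = a * z" using r_ex by blast
    obtain b where b: "b \<in> G" "b * a = 1" using inv a by blast
    obtain i where i: "i < m" "q i = r z" using q z by (force simp: bij_betw_def T_def)
    have "z = b * r z" using a b by (simp flip: mult.assoc)
    moreover obtain p where "b = g ^ p" using b by (auto simp: Gg)
    \<comment> \<open>The extra \<open>k\<close> leaves the point unchanged because
      \<open>g ^ k = 1\<close>, and makes the index positive, as
      \<open>cyclic_on_enumeration\<close> demands at \<open>e 0\<close>.\<close>
    ultimately have "e (i + m * (p + k)) = z"
      using i gk unfolding e_shift by (simp add: e_def power_add)
    moreover have "i + m * (p + k) > 0" using m k by simp
    ultimately show ?thesis by blast
  qed
  \<comment> \<open>A point determines its orbit, hence the remainder modulo \<open>m\<close>; by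
    freeness it also determines the power of \<open>g\<close>, though not the exponent. Both are
    enough to determine the next point, so \<open>\<sigma>\<close> below does not depend on the
    chosen index.\<close>
  have e_Suc: "e (Suc i) = e (Suc j)" if eq: "e i = e j" for i j
  proof -
    have "r (e l) = q (l mod m)" for l
      unfolding e_def using m qT by (subst r_inv) (auto simp: Gg rT)
    then have "q (i mod m) = q (j mod m)" using eq by metis
    then have mod: "i mod m = j mod m"
      using q m by (auto simp: bij_betw_def inj_on_def)
    have "g ^ (i div m) = g ^ (j div m)"
    proof -
      have z: "q (j mod m) \<in> Q" using m qT TQ by auto
      obtain b where b: "b \<in> G" "b * g ^ (j div m) = 1" using inv Gg by blast
      have "(b * g ^ (i div m)) * q (j mod m) = b * e i" by (simp add: e_def mod)
      also have "\<dots> = (b * g ^ (j div m)) * q (j mod m)" unfolding eq by (simp add: e_def)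
      finally have "b * g ^ (i div m) = 1"
        using b z G(4)[OF b(1)] by (intro free[of _ "q (j mod m)"]) (auto simp: Gg)
      with b(2) show ?thesis by (metis mult_left_cancel mult_zero_left zero_neq_one)
    qed
    with mod show ?thesis by (simp add: e_def div_Suc mod_Suc)
  qed
  define \<sigma> where "\<sigma> z = e (Suc (SOME j. e j = z))" for z
  have step: "\<sigma> (e j) = e (Suc j)" for j
    unfolding \<sigma>_def by (rule e_Suc, rule someI, rule refl)
  have "range e = Q" using e_Q e_surj by blast
  moreover have "e 0 \<in> e ` {0<..}" using e_surj[OF e_Q[of 0]] by (metis greaterThan_iff imageI)
  then have "cyclic_on \<sigma> (range e)" using step by (intro cyclic_on_enumeration)
  ultimately have "cyclic_on \<sigma> Q" by simp
  moreover have "\<sigma> (a * z) = a * \<sigma> z" if "a \<in> G" "z \<in> Q" for a z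
  proof -
    obtain j where "e j = z" using e_surj \<open>z \<in> Q\<close> by blast
    moreover obtain p where "a = g ^ p" using \<open>a \<in> G\<close> Gg by blast
    ultimately show ?thesis
      using step[of j] step[of "j + m * p"] e_shift[of j] e_shift[of "Suc j"] by simp
  qed
  ultimately show ?thesis using that by blast
qed

section \<open>Patterns of positions and axis vectors, and their symmetries\<close>

type_synonym pattern = "complex set \<times> complex multiset"

text \<open>For \<open>a \<noteq> 0\<close> this is the action of the orientation-preserving
  similarities of the plane that fix the origin.\<close>

definition dilate :: "complex \<Rightarrow> pattern \<Rightarrow> pattern" where
  "dilate a D = ((*) a ` fst D, image_mset ((*) a) (snd D))"

definition stabilizer :: "pattern \<Rightarrow> complex set" where
  "stabilizer D = {a. a \<noteq> 0 \<and> dilate a D = D}"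

text \<open>One axis vector per position makes the exponent in \<open>stabilizer_power_eq_1\<close>
  the number of positions; excluding zero vectors lets the product of the axes be cancelled
  there.\<close>

definition proper :: "pattern \<Rightarrow> bool" where
  "proper D \<longleftrightarrow> finite (fst D) \<and> fst D \<noteq> {} \<and> size (snd D) = card (fst D) \<and> 0 \<notin># snd D"

lemma dilate_1 [simp]: "dilate 1 D = D"
  by (simp add: dilate_def multiset.map_ident_strong)

lemma dilate_dilate [simp]: "dilate a (dilate b D) = dilate (a * b) D"
  unfolding dilate_def fst_conv snd_conv image_image multiset.map_comp o_def
  by (simp add: mult.assoc cong: multiset.map_cong)

lemma proper_dilate:
  assumes "proper D" "a \<noteq> 0"
  shows "proper (dilate a D)"
  using assms by (auto simp: proper_def dilate_def card_image inj_on_def)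

lemma stabilizer_power_eq_1:
  assumes D: "proper D" and a: "a \<in> stabilizer D"
  shows "a ^ card (fst D) = 1"
proof -
  have "prod_mset (snd D) = prod_mset (image_mset ((*) a) (snd D))"
    using a by (metis (mono_tags, lifting) mem_Collect_eq dilate_def snd_conv stabilizer_def)
  also have "\<dots> = a ^ size (snd D) * prod_mset (snd D)"
    by (simp add: prod_mset.distrib)
  finally show ?thesis using D by (auto simp: proper_def)
qed

lemma stabilizer_free:
  assumes D: "proper D" and a: "a \<in> stabilizer D" and z: "z \<in> fst D" and eq: "a * z = z"
  shows "a = 1"
proof (cases "z = 0")
  case True
  \<comment> \<open>Removing the fixed origin leaves one point fewer, so \<open>a\<close> has two
    consecutive powers equal to 1.\<close>
  define Q where "Q = fst D - {0}"
  have a0: "a \<noteq> 0" and "(*) a ` fst D = fst D"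
    using a by (auto simp: stabilizer_def dilate_def prod_eq_iff)
  then have img: "(*) a ` Q = Q"
    unfolding Q_def by (subst image_set_diff) (auto simp: inj_def)
  have fin: "finite Q" using D by (simp add: Q_def proper_def)
  have inj: "inj_on ((*) a) Q" using a0 by (auto simp: inj_on_def)
  have "\<Prod>Q = prod id ((*) a ` Q)" by (simp add: img)
  also have "\<dots> = a ^ card Q * \<Prod>Q" by (simp add: prod.reindex[OF inj] prod.distrib)
  finally have "a ^ card Q = 1" using fin by (auto simp: Q_def)
  moreover have "card (fst D) = Suc (card Q)"
    using D z True unfolding Q_def proper_def by (metis card.remove)
  ultimately show ?thesis using stabilizer_power_eq_1[OF D a] by simp
qed (use eq in simp)

lemma stabilizer_equivariant_cycle:
  assumes D: "proper D"
  shows "\<exists>\<sigma>. cyclic_on \<sigma> (fst D) \<and> (\<forall>a\<in>stabilizer D. \<forall>z\<in>fst D. \<sigma> (a * z) = a * \<sigma> z)"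
proof -
  have "card (fst D) \<noteq> 0" using D by (auto simp: proper_def)
  then have "finite {a::complex. a ^ card (fst D) = 1}" by (intro finite_roots_unity) simp
  then have "finite (stabilizer D)"
    by (rule finite_subset[rotated]) (use stabilizer_power_eq_1[OF D] in auto)
  moreover have "1 \<in> stabilizer D" "0 \<notin> stabilizer D" by (simp_all add: stabilizer_def)
  moreover have "a * b \<in> stabilizer D" if "a \<in> stabilizer D" "b \<in> stabilizer D" for a b
    using that by (auto simp: stabilizer_def simp flip: dilate_dilate)
  moreover have "finite (fst D)" "fst D \<noteq> {}" using D by (simp_all add: proper_def)
  moreover have "a * z \<in> fst D" if "a \<in> stabilizer D" "z \<in> fst D" for a z
    using that by (auto simp: stabilizer_def dilate_def prod_eq_iff)
  ultimately show ?thesis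
    using stabilizer_free[OF D] by (rule equivariant_cycle) blast+
qed

section \<open>Transporting a cycle within a similarity class\<close>

text \<open>The choice is made from the whole class of \<open>D\<close> under dilation, so all
  members of a class share it.\<close>

definition representative :: "pattern \<Rightarrow> pattern" where
  "representative D = (SOME E. \<exists>a. a \<noteq> 0 \<and> E = dilate a D)"

text \<open>This factor is determined only up to the stabilizer of the representative.\<close>

definition ratio :: "pattern \<Rightarrow> complex" where
  "ratio D = (SOME a. a \<noteq> 0 \<and> D = dilate a (representative D))"

definition base_cycle :: "pattern \<Rightarrow> complex \<Rightarrow> complex" where
  "base_cycle D = (SOME \<sigma>. cyclic_on \<sigma> (fst D) \<and>
     (\<forall>a\<in>stabilizer D. \<forall>z\<in>fst D. \<sigma> (a * z) = a * \<sigma> z))"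

definition pattern_cycle :: "pattern \<Rightarrow> complex \<Rightarrow> complex" where
  "pattern_cycle D z = ratio D * base_cycle (representative D) (z / ratio D)"

lemma representative_dilate:
  assumes "a \<noteq> 0"
  shows "representative (dilate a D) = representative D"
proof -
  have "(\<exists>b. b \<noteq> 0 \<and> E = dilate b (dilate a D)) \<longleftrightarrow> (\<exists>b. b \<noteq> 0 \<and> E = dilate b D)" for E
  proof
    assume "\<exists>b. b \<noteq> 0 \<and> E = dilate b D"
    then obtain b where "b \<noteq> 0" "E = dilate b D" by blast
    with assms show "\<exists>b. b \<noteq> 0 \<and> E = dilate b (dilate a D)"
      by (intro exI[of _ "b / a"]) auto
  next
    assume "\<exists>b. b \<noteq> 0 \<and> E = dilate b (dilate a D)"
    with assms show "\<exists>b. b \<noteq> 0 \<and> E = dilate b D"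
      using no_zero_divisors by (metis dilate_dilate)
  qed
  then show ?thesis by (simp add: representative_def)
qed

lemma representative_eq_dilate: "\<exists>a. a \<noteq> 0 \<and> representative D = dilate a D"
  unfolding representative_def by (rule someI_ex) (use zero_neq_one in blast)

lemma ratio: "ratio D \<noteq> 0" "D = dilate (ratio D) (representative D)"
proof -
  obtain a where "a \<noteq> 0" "representative D = dilate a D" using representative_eq_dilate by blast
  then have "1 / a \<noteq> 0 \<and> D = dilate (1 / a) (representative D)" by simp
  then have "ratio D \<noteq> 0 \<and> D = dilate (ratio D) (representative D)"
    unfolding ratio_def by (rule someI)
  then show "ratio D \<noteq> 0" "D = dilate (ratio D) (representative D)" by auto
qed

lemma proper_representative: "proper D \<Longrightarrow> proper (representative D)"
  using representative_eq_dilate proper_dilate by metis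

lemma base_cycle:
  assumes "proper D"
  shows "cyclic_on (base_cycle D) (fst D)"
    and "a \<in> stabilizer D \<Longrightarrow> z \<in> fst D \<Longrightarrow> base_cycle D (a * z) = a * base_cycle D z"
  using someI_ex[OF stabilizer_equivariant_cycle[OF assms]] unfolding base_cycle_def by auto

lemma cyclic_on_pattern_cycle:
  assumes "proper D"
  shows "cyclic_on (pattern_cycle D) (fst D)"
proof -
  have "cyclic_on (pattern_cycle D) ((*) (ratio D) ` fst (representative D))"
    by (rule cyclic_on_image[OF base_cycle(1)])
      (use assms ratio(1)[of D] in \<open>auto simp: pattern_cycle_def proper_representative\<close>)
  also have "(*) (ratio D) ` fst (representative D) = fst D"
    by (subst (3) ratio(2)) (simp add: dilate_def)
  finally show ?thesis .
qed

text \<open>The choice made by \<open>ratio\<close> is harmless: two possible factors differ by an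
  element \<open>b\<close> of the stabilizer of the representative, and the base cycle commutes with
  \<open>b\<close>.\<close>

lemma pattern_cycle_eq:
  assumes D: "proper D" and a: "a \<noteq> 0" "D = dilate a (representative D)" and z: "z \<in> fst D"
  shows "pattern_cycle D z = a * base_cycle (representative D) (z / a)"
proof -
  define b where "b = a / ratio D"
  have b: "ratio D * b = a" "b \<noteq> 0" using ratio(1)[of D] a(1) by (simp_all add: b_def)
  have "dilate b (representative D) = dilate (1 / ratio D) (dilate a (representative D))"
    by (simp add: b_def)
  also have "\<dots> = dilate (1 / ratio D) (dilate (ratio D) (representative D))"
    using a(2) ratio(2)[of D] by simp
  finally have "b \<in> stabilizer (representative D)"
    using ratio(1)[of D] b(2) by (simp add: stabilizer_def)
  moreover have "z / a \<in> fst (representative D)"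
  proof -
    from z have "z \<in> fst (dilate a (representative D))" using a(2) by simp
    then show ?thesis using a(1) by (auto simp: dilate_def)
  qed
  ultimately have "base_cycle (representative D) (b * (z / a)) =
      b * base_cycle (representative D) (z / a)"
    using base_cycle(2) D proper_representative by blast
  moreover have "b * (z / a) = z / ratio D" using a(1) by (simp add: b_def)
  ultimately show ?thesis using b(1) by (simp add: pattern_cycle_def flip: mult.assoc)
qed

lemma pattern_cycle_dilate:
  assumes D: "proper D" and a: "a \<noteq> 0" and z: "z \<in> fst D"
  shows "pattern_cycle (dilate a D) (a * z) = a * pattern_cycle D z"
proof -
  \<comment> \<open>\<open>a * ratio D\<close> is a valid factor for the dilated pattern, whose own
    \<open>ratio\<close> may be a different one; \<open>pattern_cycle_eq\<close> bridges the
    two.\<close>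
  have "dilate a D = dilate (a * ratio D) (representative (dilate a D))"
    using ratio(2)[of D] a by (metis representative_dilate dilate_dilate)
  then have "pattern_cycle (dilate a D) (a * z) =
      a * ratio D * base_cycle (representative (dilate a D)) (a * z / (a * ratio D))"
    by (rule pattern_cycle_eq[rotated 2])
      (use proper_dilate[OF D a] a z ratio(1)[of D] in \<open>auto simp: dilate_def\<close>)
  then show ?thesis using a by (simp add: pattern_cycle_def representative_dilate)
qed

section \<open>Removing the dependence on the origin\<close>

definition centroid :: "complex set \<Rightarrow> complex" where
  "centroid P = \<Sum>P / of_nat (card P)"

text \<open>Only the positions are centred: axis vectors are free vectors, unaffected by
  translation.\<close>

definition next_point :: "complex set \<Rightarrow> complex multiset \<Rightarrow> complex \<Rightarrow> complex" where
  "next_point P M z = centroid P + pattern_cycle ((\<lambda>w. w - centroid P) ` P, M) (z - centroid P)"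

lemma proper_translate:
  assumes "proper (P, M)"
  shows "proper ((\<lambda>w. w - b) ` P, M)"
  using assms by (auto simp: proper_def card_image inj_on_def)

lemma cyclic_on_next_point:
  assumes "proper (P, M)"
  shows "cyclic_on (next_point P M) P"
proof -
  have "cyclic_on (next_point P M) ((\<lambda>w. w + centroid P) ` (\<lambda>w. w - centroid P) ` P)"
    using cyclic_on_pattern_cycle[OF proper_translate[OF assms, of "centroid P"]]
    by (intro cyclic_on_image[where f = "pattern_cycle ((\<lambda>w. w - centroid P) ` P, M)"
          and h = "\<lambda>w. w + centroid P"])
      (auto simp: next_point_def)
  then show ?thesis by (simp add: image_image)
qed

lemma centroid_affine:
  assumes "finite P" "P \<noteq> {}" "a \<noteq> 0"
  shows "centroid ((\<lambda>w. (w - b) / a) ` P) = (centroid P - b) / a"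
proof -
  have inj: "inj_on (\<lambda>w. (w - b) / a) P" using assms by (auto simp: inj_on_def)
  have "\<Sum>((\<lambda>w. (w - b) / a) ` P) = (\<Sum>w\<in>P. (w - b) / a)"
    by (simp add: sum.reindex[OF inj])
  also have "\<dots> = (\<Sum>P - of_nat (card P) * b) / a"
    by (simp add: sum_subtractf flip: sum_divide_distrib)
  finally show ?thesis
    using assms unfolding centroid_def card_image[OF inj] by (simp add: field_simps)
qed

text \<open>The centroid moves along with an affine change of coordinates, so after centring only a
  dilation by \<open>1 / a\<close> remains, and \<open>pattern_cycle\<close> is equivariant under
  it.\<close>

lemma next_point_affine:
  assumes P: "proper (P, M)" and a: "a \<noteq> 0" and z: "z \<in> P"
  shows "next_point ((\<lambda>w. (w - b) / a) ` P) (image_mset (\<lambda>u. u / a) M) ((z - b) / a) =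
    (next_point P M z - b) / a"
proof -
  define c where "c = centroid P"
  define D where "D = ((\<lambda>w. w - c) ` P, M)"
  have c: "centroid ((\<lambda>w. (w - b) / a) ` P) = (c - b) / a"
    using P a by (auto simp: proper_def c_def centroid_affine)
  have sub: "(w - b) / a - (c - b) / a = (1 / a) * (w - c)" for w
    by (simp flip: diff_divide_distrib)
  have div: "(*) (1 / a) = (\<lambda>u. u / a)" by (simp add: fun_eq_iff)
  have D': "((\<lambda>w. w - (c - b) / a) ` (\<lambda>w. (w - b) / a) ` P, image_mset (\<lambda>u. u / a) M) =
      dilate (1 / a) D"
    by (simp add: dilate_def D_def image_image sub div)
  have "pattern_cycle (dilate (1 / a) D) (1 / a * (z - c)) = 1 / a * pattern_cycle D (z - c)"
    by (rule pattern_cycle_dilate)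
      (use P a z proper_translate in \<open>auto simp: D_def\<close>)
  then show ?thesis
    unfolding next_point_def c D' sub by (simp add: D_def c_def add_divide_distrib diff_divide_distrib)
qed

section \<open>Frames as complex numbers\<close>

text \<open>The sign \<open>s\<close> is meant to be a handedness: 1 gives the usual identification
  of the planes, -1 its complex conjugate.\<close>

definition to_complex :: "real \<Rightarrow> point \<Rightarrow> complex" where
  "to_complex s v = Complex (v $ 1) (s * v $ 2)"

definition of_complex :: "complex \<Rightarrow> point" where
  "of_complex z = vector [Re z, Im z]"

lemma to_complex_of_complex: "to_complex 1 (of_complex z) = z"
  by (simp add: to_complex_def of_complex_def)

lemma to_complex_add: "to_complex s (v + w) = to_complex s v + to_complex s w"
  by (simp add: to_complex_def complex_eq_iff algebra_simps)

lemma to_complex_diff: "to_complex s (v - w) = to_complex s v - to_complex s w"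
  by (simp add: to_complex_def complex_eq_iff algebra_simps)

lemma to_complex_eq_iff:
  assumes "s \<noteq> 0"
  shows "to_complex s v = to_complex s w \<longleftrightarrow> v = w"
  using assms by (simp add: to_complex_def vec_eq_iff forall_2)

text \<open>The determinant \<open>D\<close> of the axes satisfies \<open>D * D = N * N\<close> by
  Lagrange's identity for orthogonal vectors of equal length. Hence the y axis is the x axis turned
  by a right angle, in the direction given by the sign of \<open>D\<close>, and the x axis and this
  sign determine the frame.\<close>

lemma cartesian_handedness:
  assumes "cartesian F"
  shows "handedness F = 1 \<or> handedness F = -1"
    and "y_axis F $ 1 = - handedness F * x_axis F $ 2"
    and "y_axis F $ 2 = handedness F * x_axis F $ 1"
proof -
  obtain x y where F: "F = Frame x y" by (cases F)
  define N where "N = x $ 1 * x $ 1 + x $ 2 * x $ 2"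
  define D where "D = x $ 1 * y $ 2 - x $ 2 * y $ 1"
  have Npos: "N > 0"
    using assms by (simp add: F N_def cartesian_def vec_eq_iff forall_2)
      (metis add_nonneg_pos add_pos_nonneg not_real_square_gt_zero zero_le_square)
  have N: "N = y $ 1 * y $ 1 + y $ 2 * y $ 2" and o: "x $ 1 * y $ 1 + x $ 2 * y $ 2 = 0"
    using assms by (auto simp: F N_def cartesian_def norm_eq inner_vec_def sum_2)
  have "D * D = N * N" using N N_def o unfolding D_def by algebra
  then have D: "D = N \<or> D = - N" by (simp add: square_eq_iff)
  have h: "handedness F = sgn D" by (simp add: F handedness_def D_def det_2 mult.commute)
  then show "handedness F = 1 \<or> handedness F = -1" using D Npos by auto
  have "sgn D * N = D" using D Npos by auto
  moreover have "D * x $ 1 = N * y $ 2" "D * x $ 2 = - N * y $ 1"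
    using N_def o unfolding D_def by algebra+
  ultimately have "N * (sgn D * x $ 1) = N * y $ 2" "N * (- sgn D * x $ 2) = N * y $ 1"
    by (metis mult.assoc mult.commute) (metis \<open>sgn D * N = D\<close> \<open>D * x $ 2 = - N * y $ 1\<close>
        minus_mult_left minus_mult_right mult.assoc mult.commute minus_minus)
  then have "sgn D * x $ 1 = y $ 2" "- sgn D * x $ 2 = y $ 1"
    using Npos unfolding mult_cancel_left by simp_all
  then show "y_axis F $ 1 = - handedness F * x_axis F $ 2"
    "y_axis F $ 2 = handedness F * x_axis F $ 1"
    unfolding h by (simp_all add: F)
qed

text \<open>With \<open>s\<close> the common handedness, \<open>to_complex s\<close> turns every frame into a right-handed one,
  so a change of coordinates becomes a complex affine map.\<close>

lemma to_complex_frame_comb: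
  assumes "cartesian F"
  shows "to_complex (handedness F) (frame_comb F v) =
    to_complex (handedness F) (x_axis F) * to_complex 1 v"
  using cartesian_handedness[OF assms]
  by (auto simp: to_complex_def frame_comb_def complex_eq_iff algebra_simps)

lemma to_complex_axis_nonzero:
  assumes "cartesian F"
  shows "to_complex (handedness F) (x_axis F) \<noteq> 0"
  using assms cartesian_handedness(1)[OF assms]
  by (auto simp: to_complex_def complex_eq_iff cartesian_def vec_eq_iff forall_2)

lemma to_complex_frame_coords:
  assumes "cartesian F"
  shows "to_complex 1 (frame_coords F v) =
    to_complex (handedness F) v / to_complex (handedness F) (x_axis F)"
  using to_complex_frame_comb[OF assms, of "frame_coords F v"] to_complex_axis_nonzero[OF assms]
  by (simp add: frame_comb_coords[OF assms] field_simps)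

section \<open>The algorithm and its global effect\<close>

text \<open>Every robot sees its own frame as right-handed, and by chirality all others too, so the
  sign is 1 and the x axes suffice. Separating positions from axes forgets which robot stands where,
  which makes the data invariant under permuting the robots. The argument 0 is the observer's own
  position.\<close>

definition visit_algorithm :: algorithm where
  "visit_algorithm S = of_complex (next_point
     (set_mset (image_mset (to_complex 1 \<circ> fst) S))
     (image_mset (to_complex 1 \<circ> x_axis \<circ> snd) S) 0)"

text \<open>Robot \<open>i\<close> sees the global picture through
  \<open>w \<mapsto> (w - c i) / u i\<close>. Equivariance of \<open>next_point\<close> cancels this
  map, so all robots follow the same global cycle although their coordinates differ.\<close>

lemma robot_step_next_point:
  fixes s :: real and C :: config and Z :: "nat \<Rightarrow> frame"
  defines "c \<equiv> \<lambda>j. to_complex s (C j)" and "u \<equiv> \<lambda>j. to_complex s (x_axis (Z j))"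
  assumes frames: "\<And>j. j < n \<Longrightarrow> cartesian (Z j)" "\<And>j. j < n \<Longrightarrow> handedness (Z j) = s"
    and inj: "inj_on C {..<n}" and i: "i < n"
  shows "to_complex s (robot_step n visit_algorithm Z C i) =
    next_point (c ` {..<n}) (image_mset u (mset_set {..<n})) (c i)"
proof -
  define P where "P = c ` {..<n}"
  define M where "M = image_mset u (mset_set {..<n})"
  have s: "s \<noteq> 0" using cartesian_handedness(1)[OF frames(1)[OF i]] frames(2)[OF i] by auto
  have u: "u j \<noteq> 0" if "j < n" for j
    using to_complex_axis_nonzero[OF frames(1)[OF that]] frames(2)[OF that] by (simp add: u_def)
  have coords: "to_complex 1 (frame_coords (Z i) v) = to_complex s v / u i" for v
    using to_complex_frame_coords[OF frames(1)[OF i]] frames(2)[OF i] by (simp add: u_def)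
  have "inj_on c {..<n}" using inj s by (auto simp: inj_on_def c_def to_complex_eq_iff)
  then have P: "proper (P, M)"
    using i u by (auto simp: proper_def P_def M_def card_image)
  have "set_mset (image_mset (to_complex 1 \<circ> fst) (snapshot n Z C i)) = (\<lambda>w. (w - c i) / u i) ` P"
    by (auto simp: snapshot_def P_def coords c_def to_complex_diff image_image)
  moreover have "image_mset (to_complex 1 \<circ> x_axis \<circ> snd) (snapshot n Z C i) =
      image_mset (\<lambda>w. w / u i) M"
    by (simp add: snapshot_def M_def coords frame_in_frame_def u_def multiset.map_comp o_def)
  moreover have "next_point ((\<lambda>w. (w - c i) / u i) ` P) (image_mset (\<lambda>w. w / u i) M) ((c i - c i) / u i) =
      (next_point P M (c i) - c i) / u i"
    by (rule next_point_affine) (use P u i in \<open>auto simp: P_def\<close>)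
  ultimately have "to_complex 1 (visit_algorithm (snapshot n Z C i)) =
      (next_point P M (c i) - c i) / u i"
    by (simp add: visit_algorithm_def to_complex_of_complex)
  then show ?thesis
    using to_complex_frame_comb[OF frames(1)[OF i]] frames(2)[OF i] u[OF i]
    by (simp add: robot_step_def to_complex_add P_def M_def c_def u_def)
qed

section \<open>From a cycle of positions to a cycle of robots, and the run\<close>

lemma cyclic_on_image_eq:
  assumes "cyclic_on \<sigma> S"
  shows "\<sigma> ` S = S"
proof -
  obtain s where s: "s \<in> S" "S = orbit \<sigma> s" using assms by (auto simp: cyclic_on_def)
  have "x \<in> \<sigma> ` S" if "x \<in> orbit \<sigma> s" for x
    using that s by cases auto
  then show ?thesis using s cyclic_on_inI[OF assms] by auto
qed

lemma n_cycle_conjugate: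
  assumes c: "inj_on c {..<n}" and \<sigma>: "cyclic_on \<sigma> (c ` {..<n})"
  obtains \<pi> where "\<pi> \<in> n_cycles n" "\<And>j. j < n \<Longrightarrow> c (\<pi> j) = \<sigma> (c j)"
proof -
  define d where "d = inv_into {..<n} c"
  \<comment> \<open>This is \<open>\<sigma>\<close> conjugated by \<open>c\<close>; outside the
    robots it is the identity, as \<open>permutes\<close> requires.\<close>
  define \<pi> where "\<pi> j = (if j < n then d (\<sigma> (c j)) else j)" for j
  have d: "d (c j) = j" if "j < n" for j using c that by (simp add: d_def)
  have cd: "c (d w) = w" if "w \<in> c ` {..<n}" for w using that by (simp add: d_def f_inv_into_f)
  have dc: "d ` c ` {..<n} = {..<n}" using d by (force simp: image_image)
  have eq: "c (\<pi> j) = \<sigma> (c j)" if "j < n" for j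
    using that cyclic_on_inI[OF \<sigma>] by (simp add: \<pi>_def cd)
  have "cyclic_on \<pi> (d ` c ` {..<n})"
    by (rule cyclic_on_image[OF \<sigma>]) (auto simp: \<pi>_def d)
  then have cyc: "cyclic_on \<pi> {..<n}" by (simp only: dc)
  then have "bij_betw \<pi> {..<n} {..<n}"
    by (simp add: bij_betw_def cyclic_on_image_eq eq_card_imp_inj_on)
  then have "\<pi> permutes {..<n}"
    by (rule bij_imp_permutes) (simp add: \<pi>_def)
  with cyc eq that show ?thesis by (simp add: n_cycles_def)
qed

lemma funpow_permute_config: "(permute_config \<pi> ^^ t) C = (\<lambda>j. C ((\<pi> ^^ t) j))"
  by (induction t) (simp_all add: permute_config_def funpow_swap1)

theorem theorem15:
  fixes n :: nat
  assumes "n \<ge> 2"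
  shows "\<exists>A :: algorithm. \<forall>C0 :: config.
           initial_config n C0 \<longrightarrow> solves_visit_all_1 n A C0"
proof (intro exI[of _ visit_algorithm] allI impI)
  fix C0 :: config
  assume "initial_config n C0"
  then have inj: "inj_on C0 {..<n}" by (simp add: initial_config_def)
  show "solves_visit_all_1 n visit_algorithm C0"
    unfolding solves_visit_all_1_def
  proof (intro allI impI)
    fix Z assume Z: "admissible n Z"
    define s where "s = handedness (Z 0)"
    have "0 < n" using assms by simp
    then have frames: "\<And>j. j < n \<Longrightarrow> cartesian (Z j)" "\<And>j. j < n \<Longrightarrow> handedness (Z j) = s"
      using Z unfolding admissible_def s_def by blast+
    have s: "s \<noteq> 0" using cartesian_handedness(1)[OF frames(1), of 0] assms by (auto simp: s_def)
    define c where "c j = to_complex s (C0 j)" for j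
    define M where "M = image_mset (\<lambda>j. to_complex s (x_axis (Z j))) (mset_set {..<n})"
    have c: "inj_on c {..<n}" using inj s by (auto simp: inj_on_def c_def to_complex_eq_iff)
    have "to_complex s (x_axis (Z j)) \<noteq> 0" if "j < n" for j
      using to_complex_axis_nonzero frames that by metis
    then have "proper (c ` {..<n}, M)"
      using \<open>0 < n\<close> by (auto simp: proper_def M_def card_image[OF c] lessThan_empty_iff)
    then have cyc: "cyclic_on (next_point (c ` {..<n}) M) (c ` {..<n})"
      by (rule cyclic_on_next_point)
    then obtain \<pi> where \<pi>: "\<pi> \<in> n_cycles n"
      and nxt: "\<And>j. j < n \<Longrightarrow> c (\<pi> j) = next_point (c ` {..<n}) M (c j)"
      using n_cycle_conjugate[OF c] by blast
    have perm: "\<pi> ^^ t permutes {..<n}" for t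
      using \<pi> unfolding n_cycles_def
      by (induction t) (auto simp only: funpow.simps permutes_id mem_Collect_eq intro: permutes_compose)
    have "\<forall>j<n. run n visit_algorithm Z C0 t j = C0 ((\<pi> ^^ t) j)" for t
    proof (induction t)
      case (Suc t)
      define C where "C = run n visit_algorithm Z C0 t"
      have C: "C j = C0 ((\<pi> ^^ t) j)" if "j < n" for j using Suc that by (simp add: C_def)
      have in_n: "(\<pi> ^^ t) j < n" if "j < n" for j
        using permutes_in_image[OF perm[of t], of j] that by simp
      have "inj_on C {..<n}"
      proof (rule inj_onI)
        fix i j assume "i \<in> {..<n}" "j \<in> {..<n}" "C i = C j"
        then have "(\<pi> ^^ t) i = (\<pi> ^^ t) j" using C in_n inj by (auto simp: inj_on_def)
        then show "i = j" using permutes_inj[OF perm[of t]] by (simp add: inj_eq)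
      qed
      note step = robot_step_next_point[where Z = Z and C = C and n = n and s = s,
          OF frames(1) frames(2) this]
      have "(\<lambda>j. to_complex s (C j)) ` {..<n} = c ` (\<pi> ^^ t) ` {..<n}"
        unfolding image_image by (rule image_cong) (auto simp: C c_def)
      also have "\<dots> = c ` {..<n}" by (simp add: permutes_image[OF perm])
      finally have P: "(\<lambda>j. to_complex s (C j)) ` {..<n} = c ` {..<n}" .
      have "run n visit_algorithm Z C0 (Suc t) j = C0 ((\<pi> ^^ Suc t) j)" if j: "j < n" for j
      proof -
        have "to_complex s (run n visit_algorithm Z C0 (Suc t) j) =
            to_complex s (robot_step n visit_algorithm Z C j)"
          by (simp add: run_def C_def)
        also have "\<dots> = next_point (c ` {..<n}) M (c ((\<pi> ^^ t) j))"
          using step[OF _ _ j] by (simp add: P M_def C[OF j] c_def)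
        also have "\<dots> = to_complex s (C0 ((\<pi> ^^ Suc t) j))"
          using nxt[OF in_n[OF j]] by (simp add: c_def)
        finally show ?thesis using s by (simp add: to_complex_eq_iff)
      qed
      then show ?case by blast
    qed (simp add: run_def)
    with \<pi> show "\<exists>\<pi>\<in>n_cycles n. \<forall>t. \<forall>j<n.
        run n visit_algorithm Z C0 t j = (permute_config \<pi> ^^ t) C0 j"
      by (auto simp: funpow_permute_config)
  qed
qed

end
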